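(* Let $(X,d)$ be an infinite $\mathbf{US}$-space generated by a labeled star graph $S(l)$ with center $c$. Then the following statements are equivalent: (i) $(X,d)$ is compact. (ii) The equality $l(c)=0$ holds and the set $A_\varepsilon:=\{x\in X: l(x)\ge\varepsilon\}$ is finite for each $\varepsilon>0$.
   Context: Let $\mathbb{R}^+=[0,\infty)$. An ultrametric on a nonempty set $X$ is a symmetric function $d\colon X\times X\to\mathbb{R}^+$ with $d(x,y)=0$ iff $x=y$ and $d(x,y)\le\max\{d(x,z),d(z,y)\}$ for all $x,y,z\in X$. A tree $T$ (finite or infinite, connected simple graph without cycles, with nonempty vertex set) is a star graph with center $c\in V(T)$ if $c$ is adjacent to every other vertex and no two vertices different from $c$ are adjacent. A labeled tree $T(l)$ is a tree $T$ with a labeling $l\colon V(T)\to\mathbb{R}^+$. For a labeled tree define $d_l(u,u)=0$ and, for $u\neq v$, $d_l(u,v)=\max_{w\in V(P)} l(w)$, where $P$ is the path joining $u$ and $v$ in $T$ (endpoints included). An ultrametric space $(X,d)$ is generated by $T(l)$ if $X=V(T)$ and $d=d_l$. An ultrametric space is a $\mathbf{US}$-space if it is generated by some labeled star graph. *)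

theory Defs
  imports "HOL-Analysis.Analysis" "Graph_Theory.Graph_Theory"
begin

text \<open>As in the locale \<open>Metric_space\<close>, nonnegativity and symmetry are required of the total
  function \<open>d\<close>. This loses no generality: an ultrametric given on \<open>X\<close> only can be extended
  by \<open>0\<close>.\<close>

definition ultrametric_space :: "'a set \<Rightarrow> ('a \<Rightarrow> 'a \<Rightarrow> real) \<Rightarrow> bool" where
  "ultrametric_space X d \<longleftrightarrow> X \<noteq> {} \<and>
     (\<forall>x y. 0 \<le> d x y) \<and>
     (\<forall>x y. d x y = d y x) \<and>
     (\<forall>x\<in>X. \<forall>y\<in>X. d x y = 0 \<longleftrightarrow> x = y) \<and>
     (\<forall>x\<in>X. \<forall>y\<in>X. \<forall>z\<in>X. d x y \<le> max (d x z) (d z y))"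

lemma ultrametric_space_imp_Metric_space:
  assumes "ultrametric_space X d"
  shows "Metric_space X d"
proof
  fix x y z assume xyz: "x \<in> X" "y \<in> X" "z \<in> X"
  have "d x z \<le> max (d x y) (d y z)"
    using assms xyz unfolding ultrametric_space_def by simp
  moreover have "0 \<le> d x y" "0 \<le> d y z"
    using assms unfolding ultrametric_space_def by auto
  ultimately show "d x z \<le> d x y + d y z"
    by linarith
qed (use assms in \<open>auto simp: ultrametric_space_def\<close>)

text \<open>A simple graph, possibly infinite, is a symmetric loop-free digraph whose arcs are pairs of
  vertices. In such a digraph \<open>u, v, u\<close> is a cycle in the sense of \<open>pre_digraph.cycle\<close> for every
  edge \<open>uv\<close>, so the library's \<open>tree\<close> does not fit; the cycles of the simple graph are the
  digraph cycles of length at least three. Connectedness includes nonemptiness.\<close>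

definition simple_tree :: "'a pair_pre_digraph \<Rightarrow> bool" where
  "simple_tree T \<longleftrightarrow> pair_bidirected_digraph T \<and>
     Digraph_Component.connected (with_proj T) \<and>
     \<not> (\<exists>p. pre_digraph.cycle (with_proj T) p \<and> 3 \<le> length p)"

definition star_graph :: "'a pair_pre_digraph \<Rightarrow> 'a \<Rightarrow> bool" where
  "star_graph S c \<longleftrightarrow> simple_tree S \<and> c \<in> pverts S \<and>
     (\<forall>x\<in>pverts S - {c}. (c, x) \<in> parcs S) \<and>
     (\<forall>x\<in>pverts S - {c}. \<forall>y\<in>pverts S - {c}. (x, y) \<notin> parcs S)"

definition labeled_tree :: "'a pair_pre_digraph \<Rightarrow> ('a \<Rightarrow> real) \<Rightarrow> bool" where
  "labeled_tree T l \<longleftrightarrow> simple_tree T \<and> (\<forall>v\<in>pverts T. 0 \<le> l v)"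

definition tree_path :: "'a pair_pre_digraph \<Rightarrow> 'a \<Rightarrow> 'a \<Rightarrow> 'a list" where
  "tree_path T u v = (THE p. vpath p (with_proj T) \<and> hd p = u \<and> last p = v)"

definition label_dist :: "'a pair_pre_digraph \<Rightarrow> ('a \<Rightarrow> real) \<Rightarrow> 'a \<Rightarrow> 'a \<Rightarrow> real" where
  "label_dist T l u v = (if u = v then 0 else Max (l ` set (tree_path T u v)))"

definition generated_by ::
  "'a set \<Rightarrow> ('a \<Rightarrow> 'a \<Rightarrow> real) \<Rightarrow> 'a pair_pre_digraph \<Rightarrow> ('a \<Rightarrow> real) \<Rightarrow> bool" where
  "generated_by X d T l \<longleftrightarrow> ultrametric_space X d \<and> labeled_tree T l \<and> X = pverts T \<and>
     (\<forall>x\<in>X. \<forall>y\<in>X. d x y = label_dist T l x y)"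

definition US_space :: "'a set \<Rightarrow> ('a \<Rightarrow> 'a \<Rightarrow> real) \<Rightarrow> bool" where
  "US_space X d \<longleftrightarrow> (\<exists>S c l. star_graph S c \<and> generated_by X d S l)"

end

theory Submission
  imports Defs
begin

text \<open>In a star a path between distinct vertices \<open>u\<close>, \<open>v\<close> visits exactly \<open>u\<close>, \<open>c\<close>, \<open>v\<close>, so
  \<open>d u v = max (l u) (max (l c) (l v))\<close>. Hence a point \<open>x\<close> has distance at least
  \<open>max (l c) (l x)\<close> from all others: a finite \<open>\<epsilon>\<close>-net of \<open>X\<close> contains \<open>A\<^sub>\<epsilon>\<close>, and even all of
  \<open>X\<close> if \<open>l c \<ge> \<epsilon> > 0\<close>. Conversely, if \<open>l c = 0\<close>, then \<open>A\<^sub>\<epsilon>\<close> contains the complement of the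
  \<open>\<epsilon>\<close>-ball around \<open>c\<close>, so every neighbourhood of \<open>c\<close> has finite complement.\<close>

text \<open>Only the arcs leaving \<open>c\<close> are prescribed by \<open>star_graph\<close>;
  bidirectedness supplies the reversed ones and excludes loops.\<close>

lemma star_graph_arcs_iff:
  assumes "star_graph S c"
  shows "(u, v) \<in> parcs S \<longleftrightarrow>
    u \<in> pverts S \<and> v \<in> pverts S \<and> u \<noteq> v \<and> (u = c \<or> v = c)"
proof -
  interpret pair_bidirected_digraph S
    using assms by (auto simp: star_graph_def simple_tree_def)
  have "(u, v) \<in> parcs S \<longleftrightarrow> (v, u) \<in> parcs S"
    using pair_sym_arcs by (auto simp: symmetric_def dest: symD)
  moreover have "(u, v) \<in> parcs S \<Longrightarrow> u \<in> pverts S \<and> v \<in> pverts S \<and> u \<noteq> v"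
    using arc_fst_in_verts arc_snd_in_verts pair_no_loops by fastforce
  ultimately show ?thesis
    using assms unfolding star_graph_def by blast
qed

text \<open>Since every arc meets \<open>c\<close>, which a path visits at most once, no path has
  more than three vertices. The uniqueness gives the \<open>THE\<close> in \<open>tree_path\<close>
  its value.\<close>

lemma star_graph_vpath_iff:
  assumes S: "star_graph S c" and "u \<noteq> v" "u \<in> pverts S" "v \<in> pverts S"
  shows "vpath p (with_proj S) \<and> hd p = u \<and> last p = v \<longleftrightarrow>
    p = (if u = c \<or> v = c then [u, v] else [u, c, v])"
    (is "?path \<longleftrightarrow> p = ?q")
proof
  note arcs = star_graph_arcs_iff[OF S]
  assume p: ?path
  consider "p = []" | x where "p = [x]" | x y where "p = [x, y]" | x y z where "p = [x, y, z]"
    | w x y z r where "p = w # x # y # z # r"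
    by (metis list.exhaust)
  then show "p = ?q"
  proof cases
    \<comment> \<open>The disjoint arcs \<open>(w, x)\<close> and \<open>(y, z)\<close> would both
      have to contain \<open>c\<close>.\<close>
    case 5
    with p have "(w, x) \<in> parcs S" "(y, z) \<in> parcs S" "distinct [w, x, y, z]"
      by (auto simp: vpath_def vwalk_def)
    then show ?thesis
      unfolding arcs by auto
  qed (use p \<open>u \<noteq> v\<close> in \<open>auto simp: vpath_def vwalk_def arcs\<close>)
next
  assume "p = ?q"
  moreover have "c \<in> pverts S"
    using S by (simp add: star_graph_def)
  ultimately show ?path
    using assms by (auto simp: vpath_def vwalk_def star_graph_arcs_iff[OF S])
qed

text \<open>If \<open>u\<close> or \<open>v\<close> is \<open>c\<close>, the path skips the middle
  vertex, but \<open>l c\<close> is then already an end label, so one formula covers both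
  cases.\<close>

lemma star_graph_label_dist:
  assumes "star_graph S c" "u \<noteq> v" "u \<in> pverts S" "v \<in> pverts S"
  shows "label_dist S l u v = max (l u) (max (l c) (l v))"
  using assms(2) unfolding label_dist_def tree_path_def star_graph_vpath_iff[OF assms]
  by (auto simp: max.commute max.left_commute)

context Metric_space
begin

text \<open>Points of \<open>A\<close> are separated from all of \<open>M\<close>, not just from
  each other, because the centers of a finite net may lie outside \<open>A\<close>.\<close>

lemma compact_space_imp_finite_isolated:
  assumes "compact_space mtopology" "0 < \<epsilon>"
    and "A \<subseteq> M" and sep: "\<And>x y. x \<in> A \<Longrightarrow> y \<in> M \<Longrightarrow> x \<noteq> y \<Longrightarrow> \<epsilon> \<le> d x y"
  shows "finite A"
proof -
  obtain K where K: "finite K" "K \<subseteq> M" "M \<subseteq> (\<Union>x\<in>K. mball x \<epsilon>)"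
    using assms(1,2) unfolding compact_space_eq_mcomplete_mtotally_bounded mtotally_bounded_def
    by meson
  have "x \<in> K" if x: "x \<in> A" for x
  proof -
    obtain y where y: "y \<in> K" "x \<in> mball y \<epsilon>"
      using x K(3) \<open>A \<subseteq> M\<close> by blast
    then have "d x y < \<epsilon>"
      by (simp add: commute)
    with sep[OF x] y K(2) show ?thesis
      by force
  qed
  with K(1) show ?thesis
    by (meson finite_subset subsetI)
qed

text \<open>A member of the cover around \<open>c\<close> leaves only finitely many points, each of
  which costs at most one further member.\<close>

lemma compact_spaceI_cofinite_balls:
  assumes "c \<in> M" and fin: "\<And>\<epsilon>. 0 < \<epsilon> \<Longrightarrow> finite (M - mball c \<epsilon>)"
  shows "compact_space mtopology"
  unfolding compact_space_def compactin_def
proof (intro conjI allI impI)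
  fix \<U> assume \<U>: "(\<forall>U\<in>\<U>. openin mtopology U) \<and> topspace mtopology \<subseteq> \<Union>\<U>"
  with \<open>c \<in> M\<close> obtain U where U: "U \<in> \<U>" "c \<in> U" "openin mtopology U"
    by auto
  then obtain r where "r > 0" "mball c r \<subseteq> U"
    using openin_mtopology by blast
  then have "finite (M - U)"
    using fin by (meson Diff_mono finite_subset order_refl)
  moreover have "M - U \<subseteq> \<Union>\<U>"
    using \<U> by auto
  ultimately obtain \<F> where "finite \<F>" "\<F> \<subseteq> \<U>" "M - U \<subseteq> \<Union>\<F>"
    using finite_subset_Union by metis
  then show "\<exists>\<F>. finite \<F> \<and> \<F> \<subseteq> \<U> \<and> topspace mtopology \<subseteq> \<Union>\<F>"
    using U(1) by (intro exI[of _ "insert U \<F>"]) auto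
qed simp

end

theorem theorem5p1:
  fixes X :: "'a set" and d :: "'a \<Rightarrow> 'a \<Rightarrow> real"
    and S :: "'a pair_pre_digraph" and l :: "'a \<Rightarrow> real" and c :: 'a
  assumes "infinite X"
    and "US_space X d"
    and "star_graph S c"
    and "generated_by X d S l"
  shows "compact_space (Metric_space.mtopology X d) \<longleftrightarrow>
    l c = 0 \<and> (\<forall>\<epsilon>>0. finite {x \<in> X. l x \<ge> \<epsilon>})"
proof -
  have X: "X = pverts S" and l_nonneg: "\<And>x. x \<in> X \<Longrightarrow> 0 \<le> l x"
    using assms(4) by (auto simp: generated_by_def labeled_tree_def)
  have c: "c \<in> X"
    using assms(3) X by (simp add: star_graph_def)
  interpret Metric_space X d
    using assms(4) ultrametric_space_imp_Metric_space unfolding generated_by_def by blast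
  have d_eq: "d x y = max (l x) (max (l c) (l y))" if "x \<in> X" "y \<in> X" "x \<noteq> y" for x y
    using assms(3,4) that star_graph_label_dist[of S c x y l] X by (simp add: generated_by_def)
  show ?thesis
  proof (intro iffI conjI allI impI)
    assume comp: "compact_space mtopology"
    show "l c = 0"
    proof (rule ccontr)
      assume "l c \<noteq> 0"
      then have "0 < l c"
        using l_nonneg[OF c] by simp
      \<comment> \<open>By \<open>d_eq\<close> distinct points are at least \<open>l c\<close>
        apart, so all of \<open>X\<close> can serve as \<open>A\<close>, with \<open>l c\<close> as
        \<epsilon>.\<close>
      then have "finite X"
        using d_eq by (intro compact_space_imp_finite_isolated[OF comp]) auto
      with assms(1) show False
        by simp
    qed
    show "finite {x \<in> X. l x \<ge> \<epsilon>}" if "0 < \<epsilon>" for \<epsilon>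
      using d_eq that by (intro compact_space_imp_finite_isolated[OF comp]) auto
  next
    assume fin: "l c = 0 \<and> (\<forall>\<epsilon>>0. finite {x \<in> X. l x \<ge> \<epsilon>})"
    show "compact_space mtopology"
    proof (rule compact_spaceI_cofinite_balls[OF c])
      fix \<epsilon> :: real assume "0 < \<epsilon>"
      have "X - mball c \<epsilon> \<subseteq> {x \<in> X. l x \<ge> \<epsilon>}"
      proof
        fix x assume "x \<in> X - mball c \<epsilon>"
        then have "x \<in> X" "\<epsilon> \<le> d c x"
          using c by auto
        moreover from this have "x \<noteq> c"
          using \<open>0 < \<epsilon>\<close> c by auto
        \<comment> \<open>As \<open>l c = 0\<close>, the distance \<open>d c x\<close> is the
          maximum of 0 and \<open>l x\<close>; being at least \<epsilon> > 0, it is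
          \<open>l x\<close>.\<close>
        ultimately show "x \<in> {x \<in> X. l x \<ge> \<epsilon>}"
          using d_eq[of c x] c fin \<open>0 < \<epsilon>\<close> by auto
      qed
      then show "finite (X - mball c \<epsilon>)"
        using fin \<open>0 < \<epsilon>\<close> finite_subset by blast
    qed
  qed
qed

end
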